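(* Let $\mathbb{K}$ be a field, let $m\ge 2$, $r\ge 2$, and let $n_1,\dots,n_r$ be positive integers with $n_r\ge 2$ and $1=n_1=n_2=\cdots=n_{s-1}<n_s\le\cdots\le n_r$ for some $s\in\{1,\dots,r\}$. Put $n=\sum_{j=1}^r n_j$, let $G=K_{n_1,\dots,n_r}$ be the complete $r$-partite graph on $[n]$, and let $S=\mathbb{K}[x_{ij}: i\in[m],\, j\in[n]]$. Then the Hilbert series of $S/\mathcal{J}_{K_m,G}$ in the variable $t$ is \[ \operatorname{Hilb}(S/\mathcal{J}_{K_m,G},t)=\frac{\sum_{i\ge 0}\binom{m-1}{i}\binom{n-1}{i}t^i}{(1-t)^{m+n-1}}+\sum_{k=s}^{r}\left(\frac{1}{(1-t)^{mn_k}}-\frac{\sum_{i\ge 0}\binom{m-1}{i}\binom{n_k-1}{i}t^i}{(1-t)^{m+n_k-1}}\right). \]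
   Context: For a positive integer $a$, $[a]=\{1,\dots,a\}$. For a finite simple graph $H$ on the vertex set $[n]$, the generalized binomial edge ideal of $H$ is the ideal $\mathcal{J}_{K_m,H}$ of $S=\mathbb{K}[x_{ij}: i\in[m], j\in[n]]$ generated by all $2$-minors $x_{ik}x_{jl}-x_{il}x_{jk}$ with $1\le i<j\le m$ and $\{k,l\}\in E(H)$, $k<l$. The complete $r$-partite graph $K_{n_1,\dots,n_r}$ has vertex set $[n]=V_1\sqcup\cdots\sqcup V_r$, where $V_k=\{1+\sum_{j=1}^{k-1}n_j,\dots,\sum_{j=1}^{k}n_j\}$, and two vertices are adjacent if and only if they lie in different parts. The index $s$ is the smallest index with $n_s\ge 2$. $S$ carries the standard grading; for a finitely generated graded $S$-module $M$, $\operatorname{Hilb}(M,t)=\sum_{d}\dim_{\mathbb{K}}(M_d)\,t^d$. Binomial coefficients $\binom{a}{i}$ with $i>a\ge 0$ are zero. *)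

theory Defs
  imports
    "HOL-Algebra.QuotRing"
    "HOL-Algebra.Embedded_Algebras"
    "HOL-Library.Poly_Mapping"
    "HOL-Computational_Algebra.Formal_Power_Series"
begin

subsection \<open>The polynomial ring \<open>S = K[x_ij : i \<in> [m], j \<in> [n]]\<close>\<close>

text \<open>
  The type below is a polynomial ring in countably many variables \<open>x_(i,j)\<close>; the ring \<open>S\<close> is
  the subring of those polynomials that involve only the variables indexed by \<open>[m] \<times> [n]\<close>.
\<close>

type_synonym expo = "(nat \<times> nat) \<Rightarrow>\<^sub>0 nat"
type_synonym 'k mpoly = "expo \<Rightarrow>\<^sub>0 'k"

definition mpoly_const :: "'k \<Rightarrow> 'k::field mpoly"
  where "mpoly_const c = Poly_Mapping.single 0 c"

definition mpoly_var :: "nat \<Rightarrow> nat \<Rightarrow> 'k::field mpoly"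
  where "mpoly_var i j = Poly_Mapping.single (Poly_Mapping.single (i, j) 1) 1"

definition mpoly_ring :: "nat \<Rightarrow> nat \<Rightarrow> 'k::field mpoly ring"
  where "mpoly_ring m n =
    \<lparr>carrier = {p. \<forall>u \<in> Poly_Mapping.keys p. Poly_Mapping.keys u \<subseteq> {1..m} \<times> {1..n}},
     monoid.mult = (*), one = 1, zero = 0, add = (+)\<rparr>"

definition expo_degree :: "expo \<Rightarrow> nat"
  where "expo_degree u = (\<Sum>v \<in> Poly_Mapping.keys u. Poly_Mapping.lookup u v)"

definition homogeneous_part :: "nat \<Rightarrow> nat \<Rightarrow> nat \<Rightarrow> 'k::field mpoly set"
  where "homogeneous_part m n d =
    {p \<in> carrier (mpoly_ring m n). \<forall>u \<in> Poly_Mapping.keys p. expo_degree u = d}"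


subsection \<open>The Hilbert series of \<open>S/J\<close>\<close>

text \<open>
  For a homogeneous ideal \<open>J\<close> the degree-\<open>d\<close> component of \<open>S/J\<close> is the image of \<open>S_d\<close>, and
  \<open>K\<close> acts on \<open>S/J\<close> through the residue classes of the constant polynomials. The series is
  taken in \<open>\<rat>[[t]]\<close>, so that the rational functions in \<open>t\<close> occurring here make sense as
  formal power series.
\<close>

definition quotient_scalars :: "nat \<Rightarrow> nat \<Rightarrow> 'k::field mpoly set \<Rightarrow> 'k mpoly set set"
  where "quotient_scalars m n J = (\<lambda>c. J +>\<^bsub>mpoly_ring m n\<^esub> mpoly_const c) ` UNIV"

definition quotient_part :: "nat \<Rightarrow> nat \<Rightarrow> 'k::field mpoly set \<Rightarrow> nat \<Rightarrow> 'k mpoly set set"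
  where "quotient_part m n J d = (\<lambda>p. J +>\<^bsub>mpoly_ring m n\<^esub> p) ` homogeneous_part m n d"

definition hilbert_series :: "nat \<Rightarrow> nat \<Rightarrow> 'k::field mpoly set \<Rightarrow> rat fps"
  where "hilbert_series m n J =
    Abs_fps (\<lambda>d. of_nat (ring.dim (mpoly_ring m n Quot J) (quotient_scalars m n J) (quotient_part m n J d)))"


subsection \<open>Generalized binomial edge ideals\<close>

text \<open>
  A finite simple graph on \<open>[n]\<close> is given by its set of edges, each edge being a two-element
  subset of \<open>[n]\<close>.
\<close>

definition two_minors :: "nat \<Rightarrow> nat set set \<Rightarrow> 'k::field mpoly set"
  where "two_minors m E =
    {mpoly_var i k * mpoly_var j l - mpoly_var i l * mpoly_var j k | i j k l.
       1 \<le> i \<and> i < j \<and> j \<le> m \<and> {k, l} \<in> E \<and> k < l}"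

definition gen_binomial_edge_ideal :: "nat \<Rightarrow> nat \<Rightarrow> nat set set \<Rightarrow> 'k::field mpoly set"
  where "gen_binomial_edge_ideal m n E = genideal (mpoly_ring m n) (two_minors m E)"

definition multipartite_block :: "(nat \<Rightarrow> nat) \<Rightarrow> nat \<Rightarrow> nat set"
  where "multipartite_block ns k = {1 + (\<Sum>j = 1..k - 1. ns j) .. (\<Sum>j = 1..k. ns j)}"

definition complete_multipartite :: "nat \<Rightarrow> (nat \<Rightarrow> nat) \<Rightarrow> nat set set"
  where "complete_multipartite r ns =
    {{u, v} | u v. \<exists>k \<in> {1..r}. \<exists>l \<in> {1..r}. k \<noteq> l \<and>
       u \<in> multipartite_block ns k \<and> v \<in> multipartite_block ns l}"


subsection \<open>Well-definedness\<close>

text \<open>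
  \<open>ring.dim\<close> is a definite description; the following facts show that it is meaningful for the
  graded components of \<open>S/J\<close>, for every proper ideal \<open>J\<close> and hence for the edge ideals.
\<close>

lemma mpoly_ring_simps [simp]:
  "monoid.mult (mpoly_ring m n) = (*)" "one (mpoly_ring m n) = 1"
  "zero (mpoly_ring m n) = 0" "add (mpoly_ring m n) = (+)"
  by (simp_all add: mpoly_ring_def)

lemma mpoly_ring_carrier_iff:
  "p \<in> carrier (mpoly_ring m n) \<longleftrightarrow>
    (\<forall>u \<in> Poly_Mapping.keys p. Poly_Mapping.keys u \<subseteq> {1..m} \<times> {1..n})"
  by (simp add: mpoly_ring_def)

lemma mpoly_ring_closed:
  fixes p q :: "'k::field mpoly"
  assumes "p \<in> carrier (mpoly_ring m n)" "q \<in> carrier (mpoly_ring m n)"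
  shows "p + q \<in> carrier (mpoly_ring m n)" "p * q \<in> carrier (mpoly_ring m n)"
    "- p \<in> carrier (mpoly_ring m n)" "p - q \<in> carrier (mpoly_ring m n)"
proof -
  show plus: "p + q \<in> carrier (mpoly_ring m n)"
    using assms Poly_Mapping.keys_add[of p q] unfolding mpoly_ring_carrier_iff by blast
  show "- p \<in> carrier (mpoly_ring m n)"
    using assms unfolding mpoly_ring_carrier_iff by (simp add: in_keys_iff)
  show "p - q \<in> carrier (mpoly_ring m n)"
    unfolding mpoly_ring_carrier_iff
  proof
    fix u assume "u \<in> Poly_Mapping.keys (p - q)"
    then have "u \<in> Poly_Mapping.keys p \<or> u \<in> Poly_Mapping.keys q"
      by (auto simp: in_keys_iff lookup_minus)
    then show "Poly_Mapping.keys u \<subseteq> {1..m} \<times> {1..n}"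
      using assms unfolding mpoly_ring_carrier_iff by blast
  qed
  show "p * q \<in> carrier (mpoly_ring m n)"
    unfolding mpoly_ring_carrier_iff
  proof
    fix w assume "w \<in> Poly_Mapping.keys (p * q)"
    then obtain u v where "u \<in> Poly_Mapping.keys p" "v \<in> Poly_Mapping.keys q" "w = u + v"
      using keys_mult[of p q] by blast
    then show "Poly_Mapping.keys w \<subseteq> {1..m} \<times> {1..n}"
      using assms Poly_Mapping.keys_add[of u v] unfolding mpoly_ring_carrier_iff by blast
  qed
qed

lemma mpoly_const_closed: "mpoly_const c \<in> carrier (mpoly_ring m n)"
  by (simp add: mpoly_ring_carrier_iff mpoly_const_def)

lemma mpoly_var_closed:
  "i \<in> {1..m} \<Longrightarrow> j \<in> {1..n} \<Longrightarrow> mpoly_var i j \<in> carrier (mpoly_ring m n)"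
  by (simp add: mpoly_ring_carrier_iff mpoly_var_def)

lemma mpoly_ring_zero_one:
  "(0 :: 'k::field mpoly) \<in> carrier (mpoly_ring m n)"
  "(1 :: 'k::field mpoly) \<in> carrier (mpoly_ring m n)"
  by (simp_all add: mpoly_ring_carrier_iff)

lemma mpoly_ring_cring: "cring (mpoly_ring m n :: 'k::field mpoly ring)"
proof (rule cringI)
  show "abelian_group (mpoly_ring m n :: 'k mpoly ring)"
  proof (rule abelian_groupI)
    fix p :: "'k mpoly" assume "p \<in> carrier (mpoly_ring m n)"
    then show "\<exists>q \<in> carrier (mpoly_ring m n). q \<oplus>\<^bsub>mpoly_ring m n\<^esub> p = \<zero>\<^bsub>mpoly_ring m n\<^esub>"
      by (intro bexI[of _ "- p"]) (auto intro: mpoly_ring_closed)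
  qed (auto simp: mpoly_ring_closed mpoly_ring_zero_one algebra_simps)
  show "comm_monoid (mpoly_ring m n :: 'k mpoly ring)"
    by (rule comm_monoidI) (auto simp: mpoly_ring_closed mpoly_ring_zero_one algebra_simps)
qed (auto simp: algebra_simps)

lemma mpoly_ring_a_inv:
  fixes p :: "'k::field mpoly"
  assumes "p \<in> carrier (mpoly_ring m n)"
  shows "\<ominus>\<^bsub>mpoly_ring m n\<^esub> p = - p"
proof -
  interpret S: cring "mpoly_ring m n :: 'k mpoly ring" by (rule mpoly_ring_cring)
  show ?thesis
    using S.minus_equality[of "- p" p] assms by (simp add: mpoly_ring_closed)
qed

lemma mpoly_consts_subfield:
  "subfield (range mpoly_const) (mpoly_ring m n :: 'k::field mpoly ring)"
proof -
  interpret S: cring "mpoly_ring m n :: 'k mpoly ring" by (rule mpoly_ring_cring)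
  have inj: "mpoly_const c = mpoly_const d \<longleftrightarrow> c = d" for c d :: 'k
    by (metis mpoly_const_def lookup_single_eq)
  have ops: "mpoly_const c + mpoly_const d = mpoly_const (c + d)"
    "mpoly_const c * mpoly_const d = mpoly_const (c * d)"
    "- mpoly_const c = mpoly_const (- c)" for c d :: 'k
    by (simp_all add: mpoly_const_def single_add mult_single single_uminus)
  have one: "mpoly_const (1::'k) = 1" and zero: "mpoly_const (0::'k) = 0"
    by (simp_all add: mpoly_const_def)
  have "subring (range mpoly_const) (mpoly_ring m n :: 'k mpoly ring)"
  proof (rule S.subringI)
    show "range mpoly_const \<subseteq> carrier (mpoly_ring m n :: 'k mpoly ring)"
      by (auto simp: mpoly_const_closed)
    show "\<one>\<^bsub>mpoly_ring m n\<^esub> \<in> range (mpoly_const :: 'k \<Rightarrow> _)"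
      using one[symmetric] by simp
  qed (auto simp: mpoly_ring_a_inv mpoly_const_closed ops)
  then have "subcring (range mpoly_const) (mpoly_ring m n :: 'k mpoly ring)"
    by (rule S.subcringI) (auto simp: mult.commute)
  moreover have "Units ((mpoly_ring m n :: 'k mpoly ring)\<lparr>carrier := range mpoly_const\<rparr>) =
      range mpoly_const - {\<zero>\<^bsub>mpoly_ring m n\<^esub>}" (is "?U = ?V")
  proof
    show "?U \<subseteq> ?V" by (auto simp: Units_def)
    show "?V \<subseteq> ?U"
    proof
      fix p assume "p \<in> ?V"
      then obtain c where p: "p = mpoly_const c" and "p \<noteq> 0" by auto
      then have "c \<noteq> 0" using zero by metis
      then have "mpoly_const (inverse c) * p = 1" "p * mpoly_const (inverse c) = 1"
        unfolding p by (simp_all add: ops one)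
      then show "p \<in> ?U" unfolding Units_def p by auto
    qed
  qed
  ultimately show ?thesis by (rule S.subfieldI)
qed

lemma homogeneous_part_span:
  fixes us :: "expo list"
  assumes "\<And>u. u \<in> set us \<Longrightarrow> Poly_Mapping.keys u \<subseteq> {1..m} \<times> {1..n}"
  shows "ring.Span (mpoly_ring m n) (range mpoly_const) (map (\<lambda>u. Poly_Mapping.single u 1) us) =
    {p :: 'k::field mpoly. Poly_Mapping.keys p \<subseteq> set us}"
  using assms
proof (induction us)
  interpret S: cring "mpoly_ring m n :: 'k mpoly ring" by (rule mpoly_ring_cring)
  case Nil
  have "Poly_Mapping.keys p = {} \<longleftrightarrow> p = 0" for p :: "'k mpoly"
    by (metis keys_zero poly_mapping_eqI in_keys_iff empty_iff lookup_zero)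
  then show ?case by auto
next
  interpret S: cring "mpoly_ring m n :: 'k mpoly ring" by (rule mpoly_ring_cring)
  case (Cons u us)
  have mult: "mpoly_const c * Poly_Mapping.single u 1 = Poly_Mapping.single u c" for c :: 'k
    by (simp add: mpoly_const_def mult_single)
  have "p \<in> S.line_extension (range mpoly_const) (Poly_Mapping.single u 1)
      {p. Poly_Mapping.keys p \<subseteq> set us} \<longleftrightarrow> Poly_Mapping.keys p \<subseteq> set (u # us)" (is "?L \<longleftrightarrow> ?R")
    for p :: "'k mpoly"
  proof
    assume ?L
    then obtain c q where q: "Poly_Mapping.keys q \<subseteq> set us" "p = Poly_Mapping.single u c + q"
      by (auto simp: S.line_extension_mem_iff mult)
    then show ?R
      using Poly_Mapping.keys_add[of "Poly_Mapping.single u c" q] by (auto split: if_splits)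
  next
    assume R: ?R
    define q where "q = p - Poly_Mapping.single u (Poly_Mapping.lookup p u)"
    have "Poly_Mapping.keys q \<subseteq> set us"
      using R by (auto simp: q_def in_keys_iff lookup_minus lookup_single when_def split: if_splits)
    moreover have "p = mpoly_const (Poly_Mapping.lookup p u) * Poly_Mapping.single u 1 + q"
      by (simp add: q_def mult)
    ultimately show ?L
      unfolding S.line_extension_mem_iff by auto
  qed
  then show ?case using Cons by auto
qed

lemma finite_expos: "finite {u. Poly_Mapping.keys u \<subseteq> {1..m} \<times> {1..n} \<and> expo_degree u = d}"
proof -
  let ?A = "{1..m} \<times> {1..n}"
  let ?U = "{u. Poly_Mapping.keys u \<subseteq> ?A \<and> expo_degree u = d}"
  have "Poly_Mapping.lookup u v \<le> d" if "u \<in> ?U" for u v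
  proof (cases "v \<in> Poly_Mapping.keys u")
    case True
    then have "Poly_Mapping.lookup u v \<le> expo_degree u"
      unfolding expo_degree_def by (intro member_le_sum) auto
    then show ?thesis using that by simp
  qed (simp add: in_keys_iff)
  then have "(\<lambda>u. restrict (Poly_Mapping.lookup u) ?A) ` ?U \<subseteq> PiE ?A (\<lambda>_. {..d})"
    unfolding image_subset_iff restrict_PiE_iff by (simp only: atMost_iff) blast
  then have "finite ((\<lambda>u. restrict (Poly_Mapping.lookup u) ?A) ` ?U)"
    by (rule finite_subset) (intro finite_PiE, auto)
  moreover have "inj_on (\<lambda>u. restrict (Poly_Mapping.lookup u) ?A) ?U"
  proof (rule inj_onI, rule poly_mapping_eqI)
    fix u w v
    assume *: "u \<in> ?U" "w \<in> ?U"
      "restrict (Poly_Mapping.lookup u) ?A = restrict (Poly_Mapping.lookup w) ?A"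
    show "Poly_Mapping.lookup u v = Poly_Mapping.lookup w v"
    proof (cases "v \<in> ?A")
      case True
      then show ?thesis using fun_cong[OF *(3), of v] by simp
    next
      case False
      then have "v \<notin> Poly_Mapping.keys u" "v \<notin> Poly_Mapping.keys w" using * by blast+
      then show ?thesis by (simp add: in_keys_iff)
    qed
  qed
  ultimately show ?thesis by (rule finite_imageD)
qed

lemma quotient_one_neq_zero:
  fixes J :: "'k::field mpoly set"
  assumes "ideal J (mpoly_ring m n)" "1 \<notin> J"
  shows "\<one>\<^bsub>mpoly_ring m n Quot J\<^esub> \<noteq> \<zero>\<^bsub>mpoly_ring m n Quot J\<^esub>"
proof -
  interpret J: ideal J "mpoly_ring m n" by fact
  show ?thesis
    using J.a_rcos_self[of 1] assms(2) by (auto simp: FactRing_def mpoly_ring_zero_one)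
qed

lemma quotient_scalars_subfield:
  fixes J :: "'k::field mpoly set"
  assumes "ideal J (mpoly_ring m n)" "1 \<notin> J"
  shows "subfield (quotient_scalars m n J) (mpoly_ring m n Quot J)"
proof -
  interpret ring_hom_ring "mpoly_ring m n" "mpoly_ring m n Quot J" "(+>\<^bsub>mpoly_ring m n\<^esub>) J"
    using assms(1) by (rule ideal.rcos_ring_hom_ring)
  show ?thesis
    using img_is_subfield(2)[OF mpoly_consts_subfield quotient_one_neq_zero[OF assms]]
    by (simp add: quotient_scalars_def image_image)
qed

lemma quotient_part_finite_dimension:
  fixes J :: "'k::field mpoly set"
  assumes "ideal J (mpoly_ring m n)" "1 \<notin> J"
  shows "ring.finite_dimension (mpoly_ring m n Quot J) (quotient_scalars m n J) (quotient_part m n J d)"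
proof -
  interpret ring_hom_ring "mpoly_ring m n" "mpoly_ring m n Quot J" "(+>\<^bsub>mpoly_ring m n\<^esub>) J"
    using assms(1) by (rule ideal.rcos_ring_hom_ring)
  obtain us where us: "set us = {u. Poly_Mapping.keys u \<subseteq> {1..m} \<times> {1..n} \<and> expo_degree u = d}"
    using finite_list[OF finite_expos] by blast
  define Us :: "'k mpoly list" where "Us = map (\<lambda>u. Poly_Mapping.single u 1) us"
  have Us: "set Us \<subseteq> carrier (mpoly_ring m n)"
    using us by (auto simp: Us_def mpoly_ring_carrier_iff)
  have "homogeneous_part m n d = R.Span (range mpoly_const) Us"
    unfolding Us_def using us
    by (subst homogeneous_part_span) (auto simp: homogeneous_part_def mpoly_ring_carrier_iff)
  moreover have "range mpoly_const \<subseteq> carrier (mpoly_ring m n :: 'k mpoly ring)"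
    using mpoly_const_closed by blast
  moreover have "quotient_scalars m n J = (+>\<^bsub>mpoly_ring m n\<^esub>) J ` range mpoly_const"
    by (simp add: quotient_scalars_def image_image)
  ultimately have "quotient_part m n J d =
      S.Span (quotient_scalars m n J) (map ((+>\<^bsub>mpoly_ring m n\<^esub>) J) Us)"
    using Span_hom[OF _ Us, of "range mpoly_const"] by (simp only: quotient_part_def)
  moreover have "set (map ((+>\<^bsub>mpoly_ring m n\<^esub>) J) Us) \<subseteq> carrier (mpoly_ring m n Quot J)"
    using Us by auto
  ultimately show ?thesis
    using S.Span_finite_dimension[OF quotient_scalars_subfield[OF assms]] by metis
qed

lemma two_minors_closed:
  assumes "\<And>e. e \<in> E \<Longrightarrow> e \<subseteq> {1..n}"
  shows "two_minors m E \<subseteq> carrier (mpoly_ring m n :: 'k::field mpoly ring)"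
proof
  fix p :: "'k mpoly" assume "p \<in> two_minors m E"
  then obtain i j k l where p: "p = mpoly_var i k * mpoly_var j l - mpoly_var i l * mpoly_var j k"
    and ij: "1 \<le> i" "i < j" "j \<le> m" and kl: "{k, l} \<in> E"
    unfolding two_minors_def by blast
  have "k \<in> {1..n}" "l \<in> {1..n}" "i \<in> {1..m}" "j \<in> {1..m}"
    using assms[OF kl] ij by auto
  then show "p \<in> carrier (mpoly_ring m n)"
    unfolding p by (intro mpoly_ring_closed mpoly_var_closed)
qed

lemma gen_binomial_edge_ideal_proper:
  assumes "\<And>e. e \<in> E \<Longrightarrow> e \<subseteq> {1..n}"
  shows "ideal (gen_binomial_edge_ideal m n E) (mpoly_ring m n :: 'k::field mpoly ring)"
    and "(1 :: 'k mpoly) \<notin> gen_binomial_edge_ideal m n E"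
proof -
  interpret S: cring "mpoly_ring m n :: 'k mpoly ring" by (rule mpoly_ring_cring)
  show "ideal (gen_binomial_edge_ideal m n E) (mpoly_ring m n :: 'k::field mpoly ring)"
    unfolding gen_binomial_edge_ideal_def by (rule S.genideal_ideal[OF two_minors_closed[OF assms]])
  define I where "I = {p \<in> carrier (mpoly_ring m n :: 'k mpoly ring). Poly_Mapping.lookup p 0 = 0}"
  have sum0: "u = 0 \<and> v = 0" if "u + v = 0" for u v :: expo
    using that by (metis add_is_0 lookup_add lookup_zero poly_mapping_eqI)
  have mult0: "Poly_Mapping.lookup (p * q) 0 = 0" if "Poly_Mapping.lookup p 0 = 0" for p q :: "'k mpoly"
  proof (rule ccontr)
    assume "Poly_Mapping.lookup (p * q) 0 \<noteq> 0"
    then have "0 \<in> Poly_Mapping.keys (p * q)" by (simp add: in_keys_iff)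
    then obtain u v where "u \<in> Poly_Mapping.keys p" "u + v = 0"
      using keys_mult[of p q] by force
    then show False using sum0[of u v] that by (simp add: in_keys_iff)
  qed
  have "ideal I (mpoly_ring m n)"
  proof (rule idealI)
    show "subgroup I (add_monoid (mpoly_ring m n))"
      by (rule S.add.subgroupI)
        (auto simp: I_def mpoly_ring_a_inv mpoly_ring_closed mpoly_ring_zero_one lookup_add)
    show "x \<otimes>\<^bsub>mpoly_ring m n\<^esub> a \<in> I" "a \<otimes>\<^bsub>mpoly_ring m n\<^esub> x \<in> I"
      if "a \<in> I" "x \<in> carrier (mpoly_ring m n)" for a x
      using that mult0[of a x] by (auto simp: I_def mpoly_ring_closed mult.commute)
  qed (rule S.ring_axioms)
  moreover have "two_minors m E \<subseteq> I"
  proof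
    fix p :: "'k mpoly" assume p: "p \<in> two_minors m E"
    have "Poly_Mapping.single (i, j) 1 \<noteq> (0 :: expo)" for i j
      by (metis lookup_single_eq lookup_zero one_neq_zero)
    then have "Poly_Mapping.lookup (mpoly_var i j :: 'k mpoly) 0 = 0" for i j
      by (simp add: mpoly_var_def lookup_single_not_eq)
    then have "Poly_Mapping.lookup p 0 = 0"
      using p by (auto simp: two_minors_def lookup_minus mult0)
    then show "p \<in> I" using p two_minors_closed[OF assms] by (auto simp: I_def)
  qed
  ultimately have "gen_binomial_edge_ideal m n E \<subseteq> I"
    unfolding gen_binomial_edge_ideal_def by (rule S.genideal_minimal)
  then show "(1 :: 'k mpoly) \<notin> gen_binomial_edge_ideal m n E"
    by (auto simp: I_def)
qed

lemma complete_multipartite_edge: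
  assumes "e \<in> complete_multipartite r ns"
  shows "e \<subseteq> {1..(\<Sum>j = 1..r. ns j)}" "card e = 2"
proof -
  obtain u v k l where e: "e = {u, v}" and kl: "k \<in> {1..r}" "l \<in> {1..r}" "k \<noteq> l"
    and uv: "u \<in> multipartite_block ns k" "v \<in> multipartite_block ns l"
    using assms unfolding complete_multipartite_def by blast
  have mono: "(\<Sum>j = 1..a. ns j) \<le> (\<Sum>j = 1..b. ns j)" if "a \<le> b" for a b
    using that by (intro sum_mono2) auto
  show "e \<subseteq> {1..(\<Sum>j = 1..r. ns j)}"
    using e uv mono[of k r] mono[of l r] kl by (auto simp: multipartite_block_def)
  have "u \<noteq> v"
  proof (cases "k < l")
    case True
    then show ?thesis using uv mono[of k "l - 1"] by (fastforce simp: multipartite_block_def)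
  next
    case False
    then show ?thesis using kl uv mono[of l "k - 1"] by (fastforce simp: multipartite_block_def)
  qed
  then show "card e = 2" by (simp add: e)
qed

end

theory Submission
  imports Defs "HOL-Library.Multiset"
begin

text \<open>The ideal is generated by differences of monomials, so the monomials of degree \<open>d\<close> modulo the
  equivalence relation generated by the moves \<open>x_ik x_jl w \<sim> x_il x_jk w\<close> (\<open>{k, l}\<close> an edge) form
  a basis of the degree-\<open>d\<close> part of the quotient. A monomial is a multiset of cells of an
  \<open>m \<times> n\<close> table. If its columns lie in a single block of the graph, no move applies to it.
  Otherwise its class is determined by the row and column margins: the cells in different blocks
  form a connected graph, so the transpositions of their row indices generate all permutations.
  Hence for \<open>d > 0\<close> the classes are the pairs of margins whose column margin meets two blocks,
  together with the monomials supported in one block.\<close>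

section \<open>Paths of column swaps between multisets of cells\<close>

inductive swap_conn :: "('b \<Rightarrow> 'b \<Rightarrow> bool) \<Rightarrow> ('a \<times> 'b) multiset \<Rightarrow> ('a \<times> 'b) multiset \<Rightarrow> bool"
  for E where
  base: "swap_conn E M M"
| exchange: "E k l \<Longrightarrow> swap_conn E ({#(i, l), (j, k)#} + M) N \<Longrightarrow> swap_conn E ({#(i, k), (j, l)#} + M) N"

lemma swap_conn_add: "swap_conn E M N \<Longrightarrow> swap_conn E (M + P) (N + P)"
proof (induction rule: swap_conn.induct)
  case (exchange k l i j M N)
  then show ?case using swap_conn.exchange[of E k l i j "M + P" "N + P"] by (simp add: add_ac)
qed (rule swap_conn.base)

text \<open>Induction on the target. A cell \<open>(i, k)\<close> of the target that
  \<open>M\<close> lacks is created by one swap, because equal margins provide a cell of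
  \<open>M\<close> in row \<open>i\<close> and another in column \<open>k\<close>. The remaining
  cells again have equal margins.\<close>

lemma swap_conn_full:
  assumes "image_mset fst M = image_mset fst N" "image_mset snd M = image_mset snd N"
  shows "swap_conn (\<lambda>_ _. True) M N"
  using assms
proof (induction N arbitrary: M)
  case empty
  then show ?case by (simp add: swap_conn.base)
next
  case (add x N)
  obtain i k where x: "x = (i, k)" by force
  have rec: "swap_conn (\<lambda>_ _. True) (add_mset x M') (add_mset x N)"
    if "image_mset fst M' = image_mset fst N" "image_mset snd M' = image_mset snd N" for M'
    using swap_conn_add[OF add.IH[OF that], of "{#x#}"] by simp
  show ?case
  proof (cases "x \<in># M")
    case True
    then obtain M' where M: "M = add_mset x M'" by (metis insert_DiffM)
    show ?thesis unfolding M by (rule rec) (use add.prems M in auto)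
  next
    case False
    have "i \<in># image_mset fst M" "k \<in># image_mset snd M"
      using add.prems x by simp_all
    then obtain j l where il: "(i, l) \<in># M" and jk: "(j, k) \<in># M" by force
    \<comment> \<open>If both were the same cell, it would be \<open>(i, k) = x\<close>, which
      \<open>M\<close> lacks. Hence two separate occurrences can be split off.\<close>
    then have "(i, l) \<noteq> (j, k)" using False x by auto
    then have "(j, k) \<in># M - {#(i, l)#}"
      using jk insert_DiffM[OF il] by (metis insert_noteq_member insert_DiffM)
    then obtain M0 where "M - {#(i, l)#} = add_mset (j, k) M0" by (metis insert_DiffM)
    then have M: "M = {#(i, l), (j, k)#} + M0" using insert_DiffM[OF il] by simp
    have "swap_conn (\<lambda>_ _. True) (add_mset x (add_mset (j, l) M0)) (add_mset x N)"
      by (rule rec) (use add.prems M x in auto)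
    then show ?thesis
      unfolding M using swap_conn.exchange[of "\<lambda>_ _. True" l k i j M0] by (simp add: x)
  qed
qed

definition mixed :: "('b \<Rightarrow> 'c) \<Rightarrow> 'b multiset \<Rightarrow> bool"
  where "mixed c X \<longleftrightarrow> (\<exists>k \<in># X. \<exists>l \<in># X. c k \<noteq> c l)"

text \<open>A swap of two columns of the same colour is a product of three swaps with a column of
  another colour, as \<open>(p q) = (p r) (q r) (p r)\<close> for transpositions.\<close>

lemma swap_conn_mixed:
  assumes "swap_conn (\<lambda>_ _. True) M N" "mixed c (image_mset snd M)"
  shows "swap_conn (\<lambda>k l. c k \<noteq> c l) M N"
  using assms
proof (induction rule: swap_conn.induct)
  case (exchange k l i j M N)
  let ?E = "\<lambda>k l. c k \<noteq> c l"
  have conn: "swap_conn ?E ({#(i, l), (j, k)#} + M) N"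
    using exchange.IH exchange.prems by (simp add: add_mset_commute)
  show ?case
  proof (cases "c k = c l")
    case False
    then show ?thesis using conn by (rule swap_conn.exchange)
  next
    case True
    have "\<exists>x \<in># M. c (snd x) \<noteq> c k"
    proof (rule ccontr)
      assume "\<not> ?thesis"
      then have "\<forall>x \<in># image_mset snd ({#(i, k), (j, l)#} + M). c x = c k"
        using True by auto
      then show False using exchange.prems unfolding mixed_def by metis
    qed
    then obtain h p where "(h, p) \<in># M" and p: "c p \<noteq> c k" by force
    then obtain M0 where M: "M = add_mset (h, p) M0" by (metis insert_DiffM)
    \<comment> \<open>The three swaps appear from last to first, since \<open>exchange\<close> puts
      a swap at the front of an existing path.\<close>
    have "swap_conn ?E ({#(j, p), (h, k)#} + add_mset (i, l) M0) N"
      by (rule swap_conn.exchange) (use p conn in \<open>simp_all add: M add_mset_commute\<close>)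
    then have conn2: "swap_conn ?E ({#(i, l), (j, p)#} + add_mset (h, k) M0) N"
      by (simp add: add_mset_commute)
    have "swap_conn ?E ({#(i, p), (j, l)#} + add_mset (h, k) M0) N"
      by (rule swap_conn.exchange[OF _ conn2]) (use p True in simp)
    then have conn3: "swap_conn ?E ({#(i, p), (h, k)#} + add_mset (j, l) M0) N"
      by (simp add: add_mset_commute)
    have "swap_conn ?E ({#(i, k), (h, p)#} + add_mset (j, l) M0) N"
      by (rule swap_conn.exchange[OF _ conn3]) (use p in simp)
    then show ?thesis by (simp add: M add_mset_commute)
  qed
qed (rule swap_conn.base)

text \<open>A complete invariant of the swap classes.\<close>

definition swap_label ::
  "('b \<Rightarrow> 'c) \<Rightarrow> ('a \<times> 'b) multiset \<Rightarrow> ('a multiset \<times> 'b multiset) + ('a \<times> 'b) multiset"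
  where "swap_label c M =
    (if mixed c (image_mset snd M) then Inl (image_mset fst M, image_mset snd M) else Inr M)"

text \<open>Completeness of the label. Equal \<open>Inl\<close> labels give equal margins, hence an
  unrestricted path, which \<open>swap_conn_mixed\<close> refines; equal \<open>Inr\<close> labels
  make the two tables equal.\<close>

lemma swap_label_conn:
  assumes "swap_label c M = swap_label c N"
  shows "swap_conn (\<lambda>k l. c k \<noteq> c l) M N"
  using assms swap_conn_mixed[OF swap_conn_full, of M N c]
  by (auto simp: swap_label_def swap_conn.base split: if_splits)

text \<open>A mixed table stays mixed and margins are additive, while an unmixed table is determined
  by its label. This makes the label compatible with multiplication by a monomial.\<close>

lemma swap_label_add:
  assumes "swap_label c M = swap_label c N"
  shows "swap_label c (P + M) = swap_label c (P + N)"
proof (cases "mixed c (image_mset snd M)")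
  case True
  then have "mixed c (image_mset snd (P + M))" by (auto simp: mixed_def)
  then show ?thesis using assms True by (auto simp: swap_label_def split: if_splits)
qed (use assms in \<open>auto simp: swap_label_def split: if_splits\<close>)

lemma swap_label_swap:
  assumes "c k \<noteq> c l"
  shows "swap_label c {#(i, k), (j, l)#} = swap_label c {#(i, l), (j, k)#}"
  using assms by (auto simp: swap_label_def mixed_def)

section \<open>Counting the swap classes of a given size\<close>

lemma card_not_mixed:
  assumes "finite B" "finite C" "c ` B \<subseteq> C" "d > 0"
  shows "card {X \<in> multisets_of_size B d. \<not> mixed c X} =
    (\<Sum>k \<in> C. card (multisets_of_size {x \<in> B. c x = k} d))"
proof -
  \<comment> \<open>For \<open>d > 0\<close> an unmixed multiset is nonempty, so it has exactly one
    colour. At \<open>d = 0\<close> the empty multiset would be counted once for every element of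
    \<open>C\<close>.\<close>
  have "{X \<in> multisets_of_size B d. \<not> mixed c X} = (\<Union>k \<in> C. multisets_of_size {x \<in> B. c x = k} d)"
  proof (intro equalityI subsetI)
    fix X assume "X \<in> {X \<in> multisets_of_size B d. \<not> mixed c X}"
    then have X: "set_mset X \<subseteq> B" "size X = d" "\<not> mixed c X"
      by (auto simp: multisets_of_size_def)
    then obtain x where x: "x \<in># X" using assms(4) by fastforce
    then have "X \<in> multisets_of_size {y \<in> B. c y = c x} d"
      using X unfolding multisets_of_size_def mixed_def by blast
    then show "X \<in> (\<Union>k \<in> C. multisets_of_size {x \<in> B. c x = k} d)"
      using x X assms(3) by blast
  next
    fix X assume "X \<in> (\<Union>k \<in> C. multisets_of_size {x \<in> B. c x = k} d)"
    then obtain k where "set_mset X \<subseteq> {x \<in> B. c x = k}" "size X = d"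
      by (auto simp: multisets_of_size_def)
    then show "X \<in> {X \<in> multisets_of_size B d. \<not> mixed c X}"
      unfolding multisets_of_size_def mixed_def by blast
  qed
  moreover have "multisets_of_size {x \<in> B. c x = k} d \<inter> multisets_of_size {x \<in> B. c x = l} d = {}"
    if "k \<noteq> l" for k l
  proof (rule ccontr)
    assume "\<not> ?thesis"
    then obtain X where X: "set_mset X \<subseteq> {x \<in> B. c x = k}" "set_mset X \<subseteq> {x \<in> B. c x = l}" "size X = d"
      by (auto simp: multisets_of_size_def)
    then obtain x where "x \<in># X" using assms(4) by fastforce
    then show False using X that by blast
  qed
  ultimately show ?thesis
    using assms(1,2) by (simp add: card_UN_disjoint finite_multisets_of_size)
qed

text \<open>List both margins in any order and pair the entries off.\<close>

lemma ex_mset_margins: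
  assumes "size a = size b"
  shows "\<exists>M. image_mset fst M = a \<and> image_mset snd M = b"
proof -
  obtain xs ys where "mset xs = a" "mset ys = b" using ex_mset by metis
  then show ?thesis
    using assms by (intro exI[of _ "mset (zip xs ys)"]) (auto simp flip: mset_map)
qed

text \<open>By \<open>ex_mset_margins\<close> every pair of margins with a mixed column margin is
  attained, and unmixed tables are their own labels. Writing unmixedness through
  \<open>c \<circ> snd\<close> allows \<open>card_not_mixed\<close> to count tables as well as
  column margins.\<close>

lemma swap_label_image:
  "swap_label c ` multisets_of_size (A \<times> B) d =
    Inl ` (multisets_of_size A d \<times> {b \<in> multisets_of_size B d. mixed c b}) \<union>
    Inr ` {M \<in> multisets_of_size (A \<times> B) d. \<not> mixed (c \<circ> snd) M}" (is "?L = ?R")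
proof -
  have mixed: "mixed (c \<circ> snd) M \<longleftrightarrow> mixed c (image_mset snd M)" for M :: "('a \<times> 'b) multiset"
    by (auto simp: mixed_def)
  show ?thesis
  proof (intro equalityI subsetI)
    fix y assume "y \<in> ?L"
    then obtain M where M: "y = swap_label c M" "set_mset M \<subseteq> A \<times> B" "size M = d"
      by (auto simp: multisets_of_size_def)
    then have "set_mset (image_mset fst M) \<subseteq> A" "set_mset (image_mset snd M) \<subseteq> B" by auto
    then show "y \<in> ?R"
      using M(2,3) unfolding M(1) swap_label_def mixed multisets_of_size_def by simp
  next
    fix y assume y: "y \<in> ?R"
    show "y \<in> ?L"
    proof (cases y)
      case (Inl ab)
      then obtain a b where ab: "y = Inl (a, b)" "set_mset a \<subseteq> A" "size a = d"
          "set_mset b \<subseteq> B" "size b = d" "mixed c b"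
        using y by (auto simp: multisets_of_size_def)
      then obtain M where M: "image_mset fst M = a" "image_mset snd M = b"
        using ex_mset_margins[of a b] by auto
      have "set_mset M \<subseteq> fst ` set_mset M \<times> snd ` set_mset M" by force
      also have "\<dots> \<subseteq> A \<times> B"
        unfolding set_image_mset[symmetric] M using ab by (intro Sigma_mono) auto
      finally have "M \<in> multisets_of_size (A \<times> B) d"
        using M ab by (auto simp: multisets_of_size_def)
      moreover have "y = swap_label c M" using M ab by (simp add: swap_label_def)
      ultimately show ?thesis by blast
    next
      case (Inr M)
      then have "M \<in> multisets_of_size (A \<times> B) d" "y = swap_label c M"
        using y by (auto simp: swap_label_def mixed)
      then show ?thesis by blast
    qed
  qed
qed

text \<open>For \<open>N = 0\<close> and \<open>d > 0\<close> this is \<open>d - 1 choose d = 0\<close>; for \<open>N = d = 0\<close> the truncated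
  subtraction gives \<open>0 choose 0 = 1\<close>.\<close>

definition multichoose :: "nat \<Rightarrow> nat \<Rightarrow> nat"
  where "multichoose N d = (N + d - 1) choose d"

text \<open>Mixed column margins are counted as all column margins minus those of a single colour;
  the unmixed tables are counted colour by colour.\<close>

lemma card_swap_label:
  assumes "finite A" "finite B" "finite C" "c ` B \<subseteq> C"
  shows "of_nat (card (swap_label c ` multisets_of_size (A \<times> B) d)) =
    (of_nat (multichoose (card A) d * multichoose (card B) d) +
      (\<Sum>k \<in> C. of_nat (multichoose (card A * card {x \<in> B. c x = k}) d) -
        of_nat (multichoose (card A) d * multichoose (card {x \<in> B. c x = k}) d)) :: rat)"
proof (cases "d = 0")
  \<comment> \<open>In degree 0 the empty table is the only one and every summand over
    \<open>C\<close> is \<open>1 - 1\<close>.\<close>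
  case True
  then show ?thesis by (simp add: multichoose_def)
next
  case False
  define b where "b k = {x \<in> B. c x = k}" for k
  have fin: "finite (b k)" for k using assms by (simp add: b_def)
  have "card {X \<in> multisets_of_size B d. mixed c X} +
      card {X \<in> multisets_of_size B d. \<not> mixed c X} = card (multisets_of_size B d)"
    using assms
    by (subst card_Un_disjoint[symmetric])
      (auto intro: arg_cong[of _ _ card] finite_subset[OF _ finite_multisets_of_size])
  then have mixed: "of_nat (card {X \<in> multisets_of_size B d. mixed c X}) =
      (of_nat (multichoose (card B) d) - (\<Sum>k \<in> C. of_nat (multichoose (card (b k)) d)) :: rat)"
    using card_not_mixed[OF assms(2-4), of d] False assms(2) fin
    by (simp add: card_multisets_of_size multichoose_def b_def flip: of_nat_sum of_nat_add)
  have "{x \<in> A \<times> B. (c \<circ> snd) x = k} = A \<times> b k" for k by (auto simp: b_def)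
  then have pure: "card {M \<in> multisets_of_size (A \<times> B) d. \<not> mixed (c \<circ> snd) M} =
      (\<Sum>k \<in> C. multichoose (card A * card (b k)) d)"
    using assms False fin
    by (subst card_not_mixed[where C = C])
      (auto simp: card_multisets_of_size multichoose_def card_cartesian_product)
  have "card (swap_label c ` multisets_of_size (A \<times> B) d) =
      multichoose (card A) d * card {X \<in> multisets_of_size B d. mixed c X} +
      (\<Sum>k \<in> C. multichoose (card A * card (b k)) d)"
    unfolding swap_label_image pure[symmetric] using assms
    by (subst card_Un_disjoint)
      (auto simp: card_image card_cartesian_product card_multisets_of_size multichoose_def
        intro: finite_subset[OF _ finite_multisets_of_size])
  then show ?thesis
    using mixed by (simp add: right_diff_distrib sum_subtractf sum_distrib_left b_def)
qed

section \<open>Power series with multiset numbers as coefficients\<close>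

lemma inverse_one_minus_fps_X_power:
  "inverse ((1 - fps_X) ^ N) = (Abs_fps (\<lambda>d. of_nat (multichoose N d)) :: 'a::field_char_0 fps)"
  if "N > 0"
  using one_minus_const_fps_X_neg_power'[of N 1] that
  by (simp add: multichoose_def)

lemma multichoose_Suc_mult: "N * multichoose (Suc N) d = (N + d) * multichoose N d"
proof (cases N)
  case 0
  then show ?thesis by (cases d) (simp_all add: multichoose_def)
next
  case (Suc M)
  have "Suc M * (Suc (M + d) choose Suc M) = Suc (M + d) * (M + d choose M)"
    using binomial_absorption[of M "Suc (M + d)"] by simp
  then show ?thesis
    using binomial_symmetric[of "Suc M" "Suc (M + d)"] binomial_symmetric[of M "M + d"]
    by (simp add: multichoose_def Suc del: binomial_Suc_Suc)
qed

text \<open>Pascal's rule; for the series with these coefficients it says that multiplying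
  \<open>(1 - t)^(-N-1)\<close> by \<open>1 - t\<close> gives \<open>(1 - t)^(-N)\<close>.\<close>

lemma multichoose_Suc:
  "multichoose (Suc N) d = multichoose N d + (if d = 0 then 0 else multichoose (Suc N) (d - 1))"
  by (cases d) (simp_all add: multichoose_def)

unbundle fps_syntax

text \<open>Over the rationals \<open>b - i\<close> may be negative, but for \<open>i > b\<close>
  both binomials vanish, so the absorption identity holds for every \<open>i\<close>.\<close>

lemma choose_Suc_mult:
  "of_nat (Suc i) * of_nat (b choose Suc i) = ((of_nat b - of_nat i) * of_nat (b choose i) :: rat)"
proof (cases "i \<le> b")
  case True
  have "Suc i * (b choose Suc i) = (b - i) * (b choose i)"
    using binomial_absorption[of i b] binomial_absorb_comp[of b i] by simp
  then show ?thesis using True by (metis of_nat_diff of_nat_mult)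
qed (simp add: binomial_eq_0)

text \<open>The numerator of the Segre Hilbert series, with both arguments lowered by one. It is a
  polynomial, kept as a power series so that it can be multiplied by powers of
  \<open>1 / (1 - t)\<close>.\<close>

definition choose_product_fps :: "nat \<Rightarrow> nat \<Rightarrow> rat fps"
  where "choose_product_fps a b = Abs_fps (\<lambda>i. of_nat ((a choose i) * (b choose i)))"

text \<open>Expresses the series for \<open>Suc a\<close> through binomials of \<open>a\<close>
  alone. In degree \<open>i + 1\<close> the left side splits into a multiple of
  \<open>a choose (i + 1)\<close> and \<open>i + 1\<close> times \<open>a choose i\<close>; that
  factor \<open>i + 1\<close> turns \<open>b choose (i + 1)\<close> into
  \<open>(b - i) * (b choose i)\<close>.\<close>

lemma choose_product_fps_Suc:
  "of_nat (Suc a) * choose_product_fps (Suc a) b =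
     Abs_fps (\<lambda>i. of_nat (a + 1 + i) * of_nat ((a choose i) * (b choose i)))
     + fps_X * Abs_fps (\<lambda>i. (of_nat b - of_nat i) * of_nat ((a choose i) * (b choose i)))"
    (is "?L = ?R")
proof (rule fps_ext)
  fix d
  have L: "?L $ d = of_nat (Suc a) * of_nat ((Suc a choose d) * (b choose d))"
    by (simp add: choose_product_fps_def fps_mult_of_nat_nth del: of_nat_Suc)
  show "?L $ d = ?R $ d"
  proof (cases d)
    case 0
    then show ?thesis unfolding L by simp
  next
    case (Suc i)
    have a: "(of_nat (a + 1 + Suc i) * of_nat (a choose Suc i) + of_nat (Suc i) * of_nat (a choose i) :: rat)
      = of_nat (Suc a) * of_nat (Suc a choose Suc i)"
      using choose_Suc_mult[of i a] by (simp add: algebra_simps)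
    have "?R $ d = of_nat (a + 1 + Suc i) * of_nat (a choose Suc i) * of_nat (b choose Suc i)
        + (of_nat b - of_nat i) * of_nat (b choose i) * of_nat (a choose i)"
      by (simp add: Suc mult_ac del: of_nat_Suc binomial_Suc_Suc)
    also have "\<dots> = (of_nat (a + 1 + Suc i) * of_nat (a choose Suc i) + of_nat (Suc i) * of_nat (a choose i))
        * of_nat (b choose Suc i)"
      unfolding choose_Suc_mult[symmetric] by (simp add: algebra_simps del: of_nat_Suc)
    also have "\<dots> = ?L $ d"
      unfolding L a by (simp add: Suc mult_ac del: of_nat_Suc binomial_Suc_Suc)
    finally show ?thesis by simp
  qed
qed

text \<open>Induction on \<open>a\<close>: with \<open>N = a + b + 1\<close>, \<open>y = d - i\<close>, \<open>U y = multichoose N y\<close> and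
  \<open>T y = multichoose (N + 1) y\<close>, the step rests on
  \<open>(a + 1 + d) U y = (a + 1 + i) T y + (b - i) T (y - 1)\<close>, where \<open>T (y - 1) = T y - U y\<close>.\<close>

lemma choose_product_fps_mult:
  "choose_product_fps a b * Abs_fps (\<lambda>d. of_nat (multichoose (a + b + 1) d)) =
     Abs_fps (\<lambda>d. of_nat (multichoose (Suc a) d * multichoose (Suc b) d))"
proof (induction a)
  case 0
  have "choose_product_fps 0 b = 1"
    by (rule fps_ext) (auto simp: choose_product_fps_def binomial_eq_0)
  then show ?case by (simp add: multichoose_def)
next
  case (Suc a)
  define T :: "rat fps" where "T = Abs_fps (\<lambda>d. of_nat (multichoose (Suc a + b + 1) d))"
  define U :: "rat fps" where "U = Abs_fps (\<lambda>d. of_nat (multichoose (a + b + 1) d))"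
  define C :: "nat \<Rightarrow> rat" where "C i = of_nat ((a choose i) * (b choose i))" for i
  define R :: "rat fps" where "R = Abs_fps (\<lambda>d. of_nat (multichoose (Suc (Suc a)) d * multichoose (Suc b) d))"
  have XT: "fps_X * T = T - U"
    by (rule fps_ext) (simp add: T_def U_def multichoose_Suc[of "Suc (a + b)"])
  have TU: "of_nat (a + b + 1) * T $ y = of_nat (a + b + 1 + y) * U $ y" for y
    using multichoose_Suc_mult[of "a + b + 1" y]
    by (simp add: T_def U_def del: of_nat_add of_nat_Suc flip: of_nat_mult)
  have "of_nat (Suc a) * (choose_product_fps (Suc a) b * T) =
      Abs_fps (\<lambda>i. of_nat (a + 1 + i) * C i) * T + Abs_fps (\<lambda>i. (of_nat b - of_nat i) * C i) * (fps_X * T)"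
    unfolding mult.assoc[symmetric] choose_product_fps_Suc C_def[symmetric] by (simp add: algebra_simps)
  also have "\<dots> = of_nat (Suc a) * R"
  proof (rule fps_ext)
    fix d
    have "(Abs_fps (\<lambda>i. of_nat (a + 1 + i) * C i) * T + Abs_fps (\<lambda>i. (of_nat b - of_nat i) * C i) * (fps_X * T)) $ d
      = (\<Sum>i = 0..d. of_nat (a + 1 + i) * C i * T $ (d - i) + (of_nat b - of_nat i) * C i * (T $ (d - i) - U $ (d - i)))"
      unfolding XT by (simp add: fps_mult_nth sum.distrib)
    also have "\<dots> = (\<Sum>i = 0..d. of_nat (Suc a + d) * (C i * U $ (d - i)))"
    proof (rule sum.cong)
      fix i assume "i \<in> {0..d}"
      then obtain y where d: "d = i + y" by (auto simp: le_iff_add)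
      have "of_nat (a + 1 + i) * C i * T $ y + (of_nat b - of_nat i) * C i * (T $ y - U $ y)
        = C i * (of_nat (a + b + 1) * T $ y - (of_nat b - of_nat i) * U $ y)"
        by (simp add: algebra_simps)
      also have "\<dots> = of_nat (Suc a + d) * (C i * U $ y)"
        unfolding TU by (simp add: algebra_simps d)
      finally show "of_nat (a + 1 + i) * C i * T $ (d - i) + (of_nat b - of_nat i) * C i * (T $ (d - i) - U $ (d - i))
        = of_nat (Suc a + d) * (C i * U $ (d - i))" by (simp add: d)
    qed simp
    also have "\<dots> = of_nat (Suc a + d) * (choose_product_fps a b * U) $ d"
      by (simp add: fps_mult_nth sum_distrib_left choose_product_fps_def C_def del: of_nat_Suc of_nat_add)
    also have "\<dots> = of_nat ((Suc a + d) * multichoose (Suc a) d * multichoose (Suc b) d)"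
      unfolding U_def Suc.IH by (simp only: fps_nth_Abs_fps of_nat_mult mult.assoc)
    \<comment> \<open>The factor \<open>Suc a + d\<close> is traded for \<open>Suc a\<close>, which
      raises the first argument of \<open>multichoose\<close>.\<close>
    also have "\<dots> = of_nat (Suc a * multichoose (Suc (Suc a)) d * multichoose (Suc b) d)"
      by (simp only: multichoose_Suc_mult)
    also have "\<dots> = (of_nat (Suc a) * R) $ d"
      by (simp only: R_def fps_mult_of_nat_nth fps_nth_Abs_fps of_nat_mult mult.assoc)
    finally show "(Abs_fps (\<lambda>i. of_nat (a + 1 + i) * C i) * T + Abs_fps (\<lambda>i. (of_nat b - of_nat i) * C i) * (fps_X * T)) $ d
      = (of_nat (Suc a) * R) $ d" .
  qed
  \<comment> \<open>The common factor \<open>Suc a\<close> is nonzero and cancels.\<close>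
  finally show ?case unfolding T_def R_def by (simp del: of_nat_Suc)
qed

section \<open>Exponents as multisets of cells\<close>

definition mset_expo :: "expo \<Rightarrow> (nat \<times> nat) multiset"
  where "mset_expo u = Abs_multiset (Poly_Mapping.lookup u)"

lemma count_mset_expo [simp]: "count (mset_expo u) = Poly_Mapping.lookup u"
  unfolding mset_expo_def by (rule count_Abs_multiset) simp

lemma mset_expo_eq_iff: "mset_expo u = mset_expo v \<longleftrightarrow> u = v"
  by (auto intro!: poly_mapping_eqI simp: multiset_eq_iff)

lemma mset_expo_add [simp]: "mset_expo (u + v) = mset_expo u + mset_expo v"
  by (rule multiset_eqI) (simp add: lookup_add)

lemma mset_expo_single [simp]: "mset_expo (Poly_Mapping.single x (Suc 0)) = {#x#}"
  by (rule multiset_eqI) (simp add: lookup_single when_def)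

lemma set_mset_expo [simp]: "set_mset (mset_expo u) = Poly_Mapping.keys u"
  by (simp add: set_mset_def keys.rep_eq)

lemma size_mset_expo: "size (mset_expo u) = expo_degree u"
  by (simp add: size_multiset_overloaded_eq expo_degree_def)

lemma surj_mset_expo: "\<exists>u. mset_expo u = M"
proof -
  have "finite {x. count M x \<noteq> 0}" by simp
  then have "mset_expo (Abs_poly_mapping (count M)) = M"
    by (intro multiset_eqI) simp
  then show ?thesis ..
qed

definition expos :: "nat \<Rightarrow> nat \<Rightarrow> nat \<Rightarrow> expo set"
  where "expos m n d = {u. Poly_Mapping.keys u \<subseteq> {1..m} \<times> {1..n} \<and> expo_degree u = d}"

lemma mset_expo_image: "mset_expo ` expos m n d = multisets_of_size ({1..m} \<times> {1..n}) d"
proof (intro equalityI subsetI)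
  fix M assume "M \<in> multisets_of_size ({1..m} \<times> {1..n}) d"
  then show "M \<in> mset_expo ` expos m n d"
    using surj_mset_expo[of M] by (auto simp: expos_def multisets_of_size_def size_mset_expo)
qed (auto simp: expos_def multisets_of_size_def size_mset_expo)

section \<open>Linear functionals and a basis of each graded piece\<close>

abbreviation monomial :: "expo \<Rightarrow> 'k::field mpoly"
  where "monomial u \<equiv> Poly_Mapping.single u 1"

text \<open>The linear functional with prescribed values on monomials. Functionals vanishing on an
  ideal serve to show that residue classes are independent.\<close>

definition linear_ext :: "(expo \<Rightarrow> 'k) \<Rightarrow> 'k::field mpoly \<Rightarrow> 'k"
  where "linear_ext g p = (\<Sum>u \<in> Poly_Mapping.keys p. Poly_Mapping.lookup p u * g u)"

lemma linear_ext_superset: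
  assumes "finite A" "Poly_Mapping.keys p \<subseteq> A"
  shows "linear_ext g p = (\<Sum>u \<in> A. Poly_Mapping.lookup p u * g u)"
  unfolding linear_ext_def using assms by (intro sum.mono_neutral_left) (auto simp: in_keys_iff)

lemma linear_ext_0 [simp]: "linear_ext g 0 = 0"
  by (simp add: linear_ext_def)

lemma linear_ext_single [simp]: "linear_ext g (Poly_Mapping.single u a) = a * g u"
  by (simp add: linear_ext_def)

lemma linear_ext_add [simp]: "linear_ext g (p + q) = linear_ext g p + linear_ext g q"
proof -
  let ?A = "Poly_Mapping.keys p \<union> Poly_Mapping.keys q"
  have "linear_ext g (p + q) = (\<Sum>u \<in> ?A. Poly_Mapping.lookup (p + q) u * g u)"
    by (intro linear_ext_superset) (simp_all add: Poly_Mapping.keys_add)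
  also have "\<dots> = linear_ext g p + linear_ext g q"
    by (simp add: linear_ext_superset[of ?A p] linear_ext_superset[of ?A q] lookup_add
        distrib_right sum.distrib)
  finally show ?thesis .
qed

lemma linear_ext_uminus [simp]: "linear_ext g (- p) = - linear_ext g p"
  using linear_ext_add[of g p "- p"] by (simp add: eq_neg_iff_add_eq_0 add.commute)

lemma linear_ext_diff [simp]: "linear_ext g (p - q) = linear_ext g p - linear_ext g q"
  using linear_ext_add[of g p "- q"] by simp

lemma mpoly_induct [case_names zero single add]:
  fixes p :: "'k::field mpoly"
  assumes "P 0" "\<And>u a. P (Poly_Mapping.single u a)" "\<And>p q. P p \<Longrightarrow> P q \<Longrightarrow> P (p + q)"
  shows "P p"
proof (induction p rule: update_induct)
  case (update f a b)
  have "Poly_Mapping.update a b f = f + Poly_Mapping.single a b"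
    using update(1)
    by (intro poly_mapping_eqI) (auto simp: lookup_update lookup_add lookup_single in_keys_iff when_def)
  then show ?case using update assms by metis
qed (rule assms(1))

lemma linear_ext_single_mult:
  "linear_ext g (Poly_Mapping.single v a * p) = a * linear_ext (\<lambda>u. g (v + u)) p"
  by (induction p rule: mpoly_induct) (simp_all add: mult_single distrib_left)

lemma linear_ext_mult_eq_0:
  assumes "\<And>v. linear_ext (\<lambda>u. g (v + u)) p = 0"
  shows "linear_ext g (q * p) = 0"
  by (induction q rule: mpoly_induct) (simp_all add: linear_ext_single_mult assms distrib_right)

text \<open>The common kernel of all functionals constant on \<open>R\<close>-related exponents.
  Multiplying by a monomial translates the functional, and by \<open>add\<close> every translate is
  again constant on \<open>R\<close>-related exponents.\<close>

lemma linear_ext_ideal: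
  fixes R :: "expo \<Rightarrow> expo \<Rightarrow> bool"
  assumes add: "\<And>u v w. R u v \<Longrightarrow> R (w + u) (w + v)"
  shows "ideal {p \<in> carrier (mpoly_ring m n :: 'k::field mpoly ring).
    \<forall>g. (\<forall>u v. R u v \<longrightarrow> g u = g v) \<longrightarrow> linear_ext g p = 0} (mpoly_ring m n)" (is "ideal ?I _")
proof (rule idealI)
  interpret S: cring "mpoly_ring m n :: 'k mpoly ring" by (rule mpoly_ring_cring)
  show "ring (mpoly_ring m n :: 'k mpoly ring)" by (rule S.ring_axioms)
  show "subgroup ?I (add_monoid (mpoly_ring m n))"
  proof (rule S.add.subgroupI)
    show "?I \<noteq> {}" using mpoly_ring_zero_one(1)[of m n, where 'k = 'k] by fastforce
    show "\<ominus>\<^bsub>mpoly_ring m n\<^esub> p \<in> ?I" if "p \<in> ?I" for p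
      using that by (simp add: mpoly_ring_a_inv mpoly_ring_closed(3)[of p m n p])
    show "p \<oplus>\<^bsub>mpoly_ring m n\<^esub> q \<in> ?I" if "p \<in> ?I" "q \<in> ?I" for p q
      using that by (simp add: mpoly_ring_closed)
  qed simp
  have closed: "q * p \<in> ?I" if p: "p \<in> ?I" and q: "q \<in> carrier (mpoly_ring m n)" for p q :: "'k mpoly"
  proof -
    have "linear_ext g (q * p) = 0" if "\<forall>u v. R u v \<longrightarrow> g u = g v" for g
    proof (rule linear_ext_mult_eq_0)
      fix w
      have "\<forall>u v. R u v \<longrightarrow> g (w + u) = g (w + v)" using that add by blast
      then show "linear_ext (\<lambda>u. g (w + u)) p = 0"
        using p by (elim CollectE conjE allE[of _ "\<lambda>u. g (w + u)"]) (rule mp)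
    qed
    then show ?thesis using p q mpoly_ring_closed(2) by blast
  qed
  show "x \<otimes>\<^bsub>mpoly_ring m n\<^esub> a \<in> ?I" "a \<otimes>\<^bsub>mpoly_ring m n\<^esub> x \<in> ?I"
    if "a \<in> ?I" "x \<in> carrier (mpoly_ring m n)" for a x
    using closed[OF that] by (simp_all only: mpoly_ring_simps mult.commute[of a x])
qed

text \<open>Monomials representing the labels form a basis: \<open>collapse\<close> makes them span,
  and \<open>separate\<close> makes them independent.\<close>

lemma dim_quotient_part:
  fixes J :: "'k::field mpoly set" and lab :: "expo \<Rightarrow> 'c"
  assumes J: "ideal J (mpoly_ring m n)" "1 \<notin> J"
    and collapse: "\<And>u v. u \<in> expos m n d \<Longrightarrow> v \<in> expos m n d \<Longrightarrow> lab u = lab v \<Longrightarrow>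
      monomial u - monomial v \<in> J"
    and separate: "\<And>g p. (\<And>u v. lab u = lab v \<Longrightarrow> g u = g v) \<Longrightarrow> p \<in> J \<Longrightarrow> linear_ext g p = 0"
  shows "ring.dim (mpoly_ring m n Quot J) (quotient_scalars m n J) (quotient_part m n J d) =
    card (lab ` expos m n d)"
proof -
  let ?S = "mpoly_ring m n :: 'k mpoly ring"
  let ?h = "(+>\<^bsub>?S\<^esub>) J"
  interpret ring_hom_ring ?S "?S Quot J" ?h
    using J(1) by (rule ideal.rcos_ring_hom_ring)
  note field = quotient_scalars_subfield[OF J]
  have subset: "range mpoly_const \<subseteq> carrier ?S" using mpoly_const_closed by blast
  have scalars: "quotient_scalars m n J = ?h ` range mpoly_const"
    by (simp add: quotient_scalars_def image_image)
  have closed: "monomial u \<in> carrier ?S" if "u \<in> expos m n d" for u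
    using that by (simp add: mpoly_ring_carrier_iff expos_def)
  have eq: "?h p = ?h q \<longleftrightarrow> p - q \<in> J" if "p \<in> carrier ?S" "q \<in> carrier ?S" for p q
    using R.quotient_eq_iff_same_a_r_cos[OF J(1) that] that
    by (simp add: a_minus_def mpoly_ring_a_inv)
  have Span: "S.Span (quotient_scalars m n J) (map (?h \<circ> monomial) us) =
      ?h ` {p. Poly_Mapping.keys p \<subseteq> set us}" if "set us \<subseteq> expos m n d" for us
  proof -
    have "set (map monomial us) \<subseteq> carrier ?S" using closed that by auto
    from Span_hom[OF subset this] show ?thesis
      using homogeneous_part_span[of us m n, where 'k = 'k] that
      by (simp add: scalars expos_def subset_iff)
  qed
  have indep: "S.independent (quotient_scalars m n J) (map (?h \<circ> monomial) us)"
    if "set us \<subseteq> expos m n d" "distinct (map lab us)" for us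
    using that
  proof (induction us)
    case (Cons u us)
    have "?h (monomial u) \<notin> S.Span (quotient_scalars m n J) (map (?h \<circ> monomial) us)"
    proof
      assume "?h (monomial u) \<in> S.Span (quotient_scalars m n J) (map (?h \<circ> monomial) us)"
      then obtain p where p: "Poly_Mapping.keys p \<subseteq> set us" "?h (monomial u) = ?h p"
        using Cons.prems by (subst (asm) Span) auto
      have "p \<in> carrier ?S"
        using p(1) Cons.prems(1) by (auto simp: mpoly_ring_carrier_iff expos_def)
      then have "monomial u - p \<in> J" using p(2) eq closed Cons.prems(1) by simp
      \<comment> \<open>The indicator of the label of \<open>u\<close> respects labels, so it kills
        \<open>J\<close>; yet it is 1 on \<open>monomial u\<close> and 0 on \<open>p\<close>, whose
        exponents carry other labels.\<close>
      then have "linear_ext (\<lambda>v. of_bool (lab v = lab u)) (monomial u - p) = 0"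
        by (rule separate[rotated]) simp
      moreover have "linear_ext (\<lambda>v. of_bool (lab v = lab u)) p = 0"
        unfolding linear_ext_def
      proof (rule sum.neutral, rule ballI)
        fix v assume "v \<in> Poly_Mapping.keys p"
        then have "lab v \<in> lab ` set us" using p(1) by blast
        then have "lab v \<noteq> lab u" using Cons.prems(2) by auto
        then show "Poly_Mapping.lookup p v * of_bool (lab v = lab u) = 0" by simp
      qed
      ultimately show False by simp
    qed
    then have "S.independent (quotient_scalars m n J) (?h (monomial u) # map (?h \<circ> monomial) us)"
      using Cons closed[of u] by (intro S.independent.li_Cons) (simp_all add: comp_def)
    then show ?case by (simp add: comp_def)
  qed auto
  have fin: "finite (expos m n d)" unfolding expos_def by (rule finite_expos)
  obtain reps where reps: "reps \<subseteq> expos m n d" "inj_on lab reps" "lab ` reps = lab ` expos m n d"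
    by (metis subset_image_inj subset_refl)
  obtain us where us: "set us = reps" "distinct us"
    using finite_distinct_list finite_subset[OF reps(1) fin] by blast
  obtain vs where vs: "set vs = expos m n d" using finite_list[OF fin] by blast
  \<comment> \<open>Every monomial has the residue class of the representative with its label, so
    the representatives span as much as all monomials of degree \<open>d\<close>.\<close>
  have "(?h \<circ> monomial) ` expos m n d = (?h \<circ> monomial) ` reps"
  proof
    show "(?h \<circ> monomial) ` expos m n d \<subseteq> (?h \<circ> monomial) ` reps"
    proof
      fix y assume "y \<in> (?h \<circ> monomial) ` expos m n d"
      then obtain v where v: "v \<in> expos m n d" "y = ?h (monomial v)" by auto
      then obtain u where u: "u \<in> reps" "lab u = lab v" using reps(3) by (metis imageE imageI)
      have "?h (monomial v) = ?h (monomial u)"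
        using u v reps(1) by (subst eq) (auto intro: closed collapse)
      then show "y \<in> (?h \<circ> monomial) ` reps" using u v by auto
    qed
  qed (use reps(1) in auto)
  then have "S.Span (quotient_scalars m n J) (map (?h \<circ> monomial) us) =
      S.Span (quotient_scalars m n J) (map (?h \<circ> monomial) vs)"
    using us vs closed reps(1) by (intro S.Span_same_set[OF field]) auto
  also have "\<dots> = quotient_part m n J d"
    unfolding quotient_part_def homogeneous_part_def
    by (subst Span) (auto simp: vs expos_def mpoly_ring_carrier_iff intro!: arg_cong[of _ _ "image _"])
  finally have "S.Span (quotient_scalars m n J) (map (?h \<circ> monomial) us) = quotient_part m n J d" .
  moreover have "S.independent (quotient_scalars m n J) (map (?h \<circ> monomial) us)"
    using us reps by (intro indep) (auto simp: distinct_map)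
  ultimately have "S.dimension (length us) (quotient_scalars m n J) (quotient_part m n J d)"
    using S.dimension_independent by fastforce
  then have "(S.dim over quotient_scalars m n J) (quotient_part m n J d) = length us"
    by (rule S.dimI[OF field])
  also have "length us = card (lab ` expos m n d)"
    using us reps by (metis card_image distinct_card)
  finally show ?thesis by (simp add: over_def)
qed

section \<open>Blocks of the graph as colour classes\<close>

definition colour :: "(nat \<Rightarrow> nat) \<Rightarrow> nat \<Rightarrow> nat"
  where "colour ns v = (LEAST k. v \<le> (\<Sum>j = 1..k. ns j))"

text \<open>Blocks are consecutive intervals ending at the partial sums of \<open>ns\<close>, so the
  block of \<open>v\<close> is named by the first partial sum that reaches \<open>v\<close>.\<close>

lemma colour_block:
  assumes "k \<ge> 1" "v \<in> multipartite_block ns k"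
  shows "colour ns v = k"
  unfolding colour_def
proof (rule Least_equality)
  show "v \<le> (\<Sum>j = 1..k. ns j)" using assms by (simp add: multipartite_block_def)
  fix y assume y: "v \<le> (\<Sum>j = 1..y. ns j)"
  show "k \<le> y"
  proof (rule ccontr)
    assume "\<not> k \<le> y"
    then have "(\<Sum>j = 1..y. ns j) \<le> (\<Sum>j = 1..k - 1. ns j)" by (intro sum_mono2) auto
    then show False using y assms by (simp add: multipartite_block_def)
  qed
qed

lemma block_colour:
  assumes "v \<in> {1..(\<Sum>j = 1..r. ns j)}"
  shows "colour ns v \<in> {1..r}" "v \<in> multipartite_block ns (colour ns v)"
proof -
  have le: "v \<le> (\<Sum>j = 1..colour ns v. ns j)" "colour ns v \<le> r"
    unfolding colour_def using assms by (auto intro: LeastI Least_le)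
  \<comment> \<open>The empty sum is 0 and \<open>v\<close> is at least 1; hence
    \<open>colour ns v - 1\<close> is a true predecessor, to which minimality applies.\<close>
  have pos: "colour ns v \<noteq> 0"
  proof
    assume "colour ns v = 0"
    then show False using le(1) assms by simp
  qed
  then have "\<not> v \<le> (\<Sum>j = 1..colour ns v - 1. ns j)"
    using not_less_Least[of "colour ns v - 1" "\<lambda>k. v \<le> (\<Sum>j = 1..k. ns j)"]
    by (simp add: colour_def)
  then show "v \<in> multipartite_block ns (colour ns v)" using le by (simp add: multipartite_block_def)
  show "colour ns v \<in> {1..r}" using pos le by simp
qed

lemma colour_class:
  assumes "k \<in> {1..r}"
  shows "{v \<in> {1..(\<Sum>j = 1..r. ns j)}. colour ns v = k} = multipartite_block ns k"
proof -
  have "(\<Sum>j = 1..k. ns j) \<le> (\<Sum>j = 1..r. ns j)" using assms by (intro sum_mono2) auto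
  then have "multipartite_block ns k \<subseteq> {1..(\<Sum>j = 1..r. ns j)}"
    by (auto simp: multipartite_block_def)
  then show ?thesis using assms block_colour(2)[of _ ns r] colour_block[of k _ ns] by auto
qed

lemma card_multipartite_block:
  assumes "k \<ge> 1"
  shows "card (multipartite_block ns k) = ns k"
  using assms by (cases k) (simp_all add: multipartite_block_def)

text \<open>Translates adjacency into the colour condition under which swaps are allowed.\<close>

lemma complete_multipartite_iff:
  assumes "k \<in> {1..(\<Sum>j = 1..r. ns j)}" "l \<in> {1..(\<Sum>j = 1..r. ns j)}"
  shows "{k, l} \<in> complete_multipartite r ns \<longleftrightarrow> colour ns k \<noteq> colour ns l"
proof
  assume "{k, l} \<in> complete_multipartite r ns"
  then obtain u v a b where "{k, l} = {u, v}" "a \<noteq> b" "a \<in> {1..r}" "b \<in> {1..r}"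
    "u \<in> multipartite_block ns a" "v \<in> multipartite_block ns b"
    unfolding complete_multipartite_def by blast
  then show "colour ns k \<noteq> colour ns l"
    using colour_block[of a u ns] colour_block[of b v ns] by (auto simp: doubleton_eq_iff)
next
  assume "colour ns k \<noteq> colour ns l"
  then show "{k, l} \<in> complete_multipartite r ns"
    using block_colour[OF assms(1)] block_colour[OF assms(2)]
    unfolding complete_multipartite_def by blast
qed

section \<open>The edge ideal and its swap classes\<close>

abbreviation minor :: "nat \<Rightarrow> nat \<Rightarrow> nat \<Rightarrow> nat \<Rightarrow> 'k::field mpoly"
  where "minor i j k l \<equiv> mpoly_var i k * mpoly_var j l - mpoly_var i l * mpoly_var j k"

abbreviation unit_expo :: "nat \<Rightarrow> nat \<Rightarrow> expo"
  where "unit_expo i k \<equiv> Poly_Mapping.single (i, k) 1"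

text \<open>The two monomials of a minor are the two sides of a swap.\<close>

lemma minor_monomial:
  "minor i j k l = monomial (unit_expo i k + unit_expo j l) - monomial (unit_expo i l + unit_expo j k)"
  by (simp add: mpoly_var_def mult_single)

context
  fixes m r n :: nat and ns :: "nat \<Rightarrow> nat" and J :: "'k::field mpoly set"
  assumes n: "n = (\<Sum>j = 1..r. ns j)"
    and J: "J = gen_binomial_edge_ideal m n (complete_multipartite r ns)"
begin

lemma edge_ideal: "ideal J (mpoly_ring m n)" "1 \<notin> J"
  unfolding J n by (rule gen_binomial_edge_ideal_proper, erule complete_multipartite_edge)+

lemma edge_ideal_0: "0 \<in> J"
  using additive_subgroup.zero_closed[OF ideal.axioms(1)[OF edge_ideal(1)]] by simp

lemma edge_ideal_add: "p \<in> J \<Longrightarrow> q \<in> J \<Longrightarrow> p + q \<in> J"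
  using additive_subgroup.a_closed[OF ideal.axioms(1)[OF edge_ideal(1)], of p q] by simp

lemma edge_ideal_uminus: "p \<in> J \<Longrightarrow> - p \<in> J"
  using additive_subgroup.a_inv_closed[OF ideal.axioms(1)[OF edge_ideal(1)], of p]
    mpoly_ring_a_inv[of p m n] ideal.Icarr[OF edge_ideal(1), of p] by simp

lemma two_minors_closed_multipartite:
  "two_minors m (complete_multipartite r ns) \<subseteq> carrier (mpoly_ring m n :: 'k mpoly ring)"
  unfolding n by (rule two_minors_closed) (rule complete_multipartite_edge)

text \<open>Generators have increasing rows and columns. Reversing either order changes the sign,
  equal rows give 0, and equal columns are excluded by the colours.\<close>

lemma minor_in_edge_ideal:
  assumes "i \<in> {1..m}" "j \<in> {1..m}" "k \<in> {1..n}" "l \<in> {1..n}" "colour ns k \<noteq> colour ns l"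
  shows "minor i j k l \<in> J"
proof -
  have gen: "minor i j k l \<in> J" if "i \<in> {1..m}" "j \<in> {1..m}" "k \<in> {1..n}" "l \<in> {1..n}"
    "colour ns k \<noteq> colour ns l" "i < j" "k < l" for i j k l
  proof -
    have "{k, l} \<in> complete_multipartite r ns"
      using that complete_multipartite_iff n by blast
    then have "minor i j k l \<in> (two_minors m (complete_multipartite r ns) :: 'k mpoly set)"
      using that by (auto simp: two_minors_def)
    then show ?thesis
      unfolding J gen_binomial_edge_ideal_def
      using ring.genideal_self[OF cring.axioms(1)[OF mpoly_ring_cring] two_minors_closed_multipartite]
      by blast
  qed
  have rows: "minor i j k l \<in> J" if "k < l" "k \<in> {1..n}" "l \<in> {1..n}" "colour ns k \<noteq> colour ns l" for k l
  proof (cases i j rule: linorder_cases)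
    case less
    then show ?thesis using gen that assms by blast
  next
    case equal
    then show ?thesis using edge_ideal_0 by (simp add: mult.commute)
  next
    case greater
    then have "minor j i k l \<in> J" using gen that assms by blast
    then show ?thesis using edge_ideal_uminus by (fastforce simp: mult.commute)
  qed
  show ?thesis
  proof (cases k l rule: linorder_cases)
    case greater
    then have "minor i j l k \<in> J" using rows assms by simp
    then show ?thesis using edge_ideal_uminus by fastforce
  qed (use rows assms in auto)
qed

text \<open>A telescoping sum along the path: each swap changes the monomial by a monomial multiple
  of a minor in \<open>J\<close>, and swaps keep the cells inside the table.\<close>

lemma swap_conn_edge_ideal:
  assumes "swap_conn (\<lambda>k l. colour ns k \<noteq> colour ns l) M N" "set_mset M \<subseteq> {1..m} \<times> {1..n}"
    "mset_expo u = M" "mset_expo v = N"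
  shows "monomial u - monomial v \<in> J"
  using assms
proof (induction arbitrary: u rule: swap_conn.induct)
  case (base M)
  then have "u = v" using mset_expo_eq_iff[of u v] by simp
  then show ?case using edge_ideal_0 by simp
next
  case (exchange k l i j M N)
  obtain w where w: "mset_expo w = M" using surj_mset_expo by blast
  let ?u = "unit_expo i l + unit_expo j k + w"
  have u: "u = unit_expo i k + unit_expo j l + w"
    using exchange.prems w by (simp flip: mset_expo_eq_iff)
  have "monomial ?u - monomial v \<in> J"
    by (rule exchange.IH) (use exchange.prems w in auto)
  moreover have "monomial w * minor i j k l \<in> J"
  proof -
    have "minor i j k l \<in> J"
      using exchange.hyps exchange.prems by (intro minor_in_edge_ideal) auto
    moreover have "monomial w \<in> carrier (mpoly_ring m n :: 'k mpoly ring)"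
      using exchange.prems by (simp add: mpoly_ring_carrier_iff flip: set_mset_expo w)
    ultimately show ?thesis using ideal.I_l_closed[OF edge_ideal(1)] by fastforce
  qed
  ultimately have "monomial w * minor i j k l + (monomial ?u - monomial v) \<in> J"
    by (intro edge_ideal_add)
  moreover have "monomial w * (minor i j k l :: 'k mpoly) = monomial u - monomial ?u"
    unfolding minor_monomial u by (simp add: right_diff_distrib mult_single add_ac)
  ultimately show ?case by simp
qed

text \<open>The common kernel of these functionals is an ideal by \<open>linear_ext_ideal\<close>,
  so the generators suffice; the two monomials of a generator have equal labels by
  \<open>swap_label_swap\<close>.\<close>

lemma linear_ext_edge_ideal:
  assumes "\<And>u v. swap_label (colour ns) (mset_expo u) = swap_label (colour ns) (mset_expo v) \<Longrightarrow> g u = g v"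
    and "p \<in> J"
  shows "linear_ext g p = 0"
proof -
  define R where "R u v \<longleftrightarrow> swap_label (colour ns) (mset_expo u) = swap_label (colour ns) (mset_expo v)" for u v
  define I where "I = {p \<in> carrier (mpoly_ring m n :: 'k mpoly ring).
    \<forall>g. (\<forall>u v. R u v \<longrightarrow> g u = g v) \<longrightarrow> linear_ext g p = 0}"
  have "ideal I (mpoly_ring m n)"
    unfolding I_def by (rule linear_ext_ideal) (auto simp: R_def intro: swap_label_add)
  moreover have "two_minors m (complete_multipartite r ns) \<subseteq> I"
  proof
    fix q :: "'k mpoly" assume q: "q \<in> two_minors m (complete_multipartite r ns)"
    then obtain i j k l where ijkl: "q = minor i j k l" "{k, l} \<in> complete_multipartite r ns"
      unfolding two_minors_def by blast
    then have "k \<in> {1..n}" "l \<in> {1..n}" using complete_multipartite_edge(1) n by blast+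
    then have "colour ns k \<noteq> colour ns l" using complete_multipartite_iff ijkl n by blast
    then have "R (unit_expo i k + unit_expo j l) (unit_expo i l + unit_expo j k)"
      using swap_label_swap[of "colour ns" k l i j] by (simp add: R_def add_mset_commute)
    then have "linear_ext g q = 0" if "\<forall>u v. R u v \<longrightarrow> g u = g v" for g
      using that unfolding ijkl minor_monomial by simp
    then show "q \<in> I" using q two_minors_closed_multipartite by (auto simp: I_def)
  qed
  ultimately have "J \<subseteq> I" unfolding J gen_binomial_edge_ideal_def 
    by (rule ring.genideal_minimal[OF cring.axioms(1)[OF mpoly_ring_cring]])
  then show ?thesis using assms by (auto simp: I_def R_def)
qed

text \<open>The labelling in \<open>dim_quotient_part\<close> is the swap label of the exponent:
  paths of swaps give \<open>collapse\<close>, and label-invariant functionals give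
  \<open>separate\<close>.\<close>

lemma hilbert_series_nth:
  "fps_nth (hilbert_series m n J) d =
    of_nat (multichoose m d * multichoose n d) +
    (\<Sum>k = 1..r. of_nat (multichoose (m * ns k) d) - of_nat (multichoose m d * multichoose (ns k) d))"
proof -
  have "ring.dim (mpoly_ring m n Quot J) (quotient_scalars m n J) (quotient_part m n J d) =
      card ((\<lambda>u. swap_label (colour ns) (mset_expo u)) ` expos m n d)"
  proof (rule dim_quotient_part[OF edge_ideal])
    fix u v assume "u \<in> expos m n d"
      "swap_label (colour ns) (mset_expo u) = swap_label (colour ns) (mset_expo v)"
    then show "monomial u - monomial v \<in> J"
      by (intro swap_conn_edge_ideal[OF swap_label_conn]) (auto simp: expos_def)
  qed (rule linear_ext_edge_ideal)
  also have "\<dots> = card (swap_label (colour ns) ` multisets_of_size ({1..m} \<times> {1..n}) d)"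
    unfolding mset_expo_image[symmetric] by (simp add: image_image)
  finally have "fps_nth (hilbert_series m n J) d =
      of_nat (card (swap_label (colour ns) ` multisets_of_size ({1..m} \<times> {1..n}) d))"
    by (simp add: hilbert_series_def)
  also have "\<dots> = of_nat (multichoose m d * multichoose n d) + (\<Sum>k = 1..r.
      of_nat (multichoose (m * card {x \<in> {1..n}. colour ns x = k}) d) -
      of_nat (multichoose m d * multichoose (card {x \<in> {1..n}. colour ns x = k}) d))"
    using block_colour(1)[of _ ns r] n by (subst card_swap_label[where C = "{1..r}"]) auto
  also have "\<dots> = of_nat (multichoose m d * multichoose n d) + (\<Sum>k = 1..r.
      of_nat (multichoose (m * ns k) d) - of_nat (multichoose m d * multichoose (ns k) d))"
  proof -
    have "card {x \<in> {1..n}. colour ns x = k} = ns k" if "k \<in> {1..r}" for k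
      using that unfolding n colour_class[OF that] by (simp add: card_multipartite_block)
    then show ?thesis by (simp only: cong: sum.cong)
  qed
  finally show ?thesis .
qed

end

text \<open>The coefficients on the right count pairs of monomials of degree \<open>d\<close> in
  \<open>a\<close> and in \<open>b\<close> variables, so this is the Hilbert series of a Segre
  product of polynomial rings. It is \<open>choose_product_fps_mult\<close> at \<open>a - 1\<close>
  and \<open>b - 1\<close>.\<close>

lemma segre_hilbert_series:
  assumes "a > 0" "b > 0"
  shows "Abs_fps (\<lambda>i. of_nat ((a - 1 choose i) * (b - 1 choose i))) / (1 - fps_X) ^ (a + b - 1) =
    (Abs_fps (\<lambda>d. of_nat (multichoose a d * multichoose b d)) :: rat fps)"
proof -
  obtain a' b' where ab: "a = Suc a'" "b = Suc b'" using assms gr0_implies_Suc by metis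
  have unit: "fps_nth ((1 - fps_X :: rat fps) ^ k) 0 \<noteq> 0" for k
    by (simp add: fps_power_zeroth)
  show ?thesis
    using choose_product_fps_mult[of a' b'] inverse_one_minus_fps_X_power[of "a' + b' + 1", where 'a = rat]
    by (simp add: ab choose_product_fps_def fps_divide_unit[OF unit] del: power_Suc)
qed

theorem proposition3p10:
  fixes m r s n :: nat and ns :: "nat \<Rightarrow> nat" and J :: "'k::field mpoly set"
  assumes "m \<ge> 2" and "r \<ge> 2"
    and "\<And>j. j \<in> {1..r} \<Longrightarrow> ns j > 0"
    and "ns r \<ge> 2"
    and "s \<in> {1..r}"
    and "\<And>j. 1 \<le> j \<Longrightarrow> j < s \<Longrightarrow> ns j = 1"
    and "1 < ns s"
    and "\<And>i j. s \<le> i \<Longrightarrow> i \<le> j \<Longrightarrow> j \<le> r \<Longrightarrow> ns i \<le> ns j"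
    and "n = (\<Sum>j = 1..r. ns j)"
    and "J = gen_binomial_edge_ideal m n (complete_multipartite r ns)"
  shows "hilbert_series m n J =
    Abs_fps (\<lambda>i. of_nat ((m - 1 choose i) * (n - 1 choose i))) / (1 - fps_X) ^ (m + n - 1)
    + (\<Sum>k = s..r. (1 / (1 - fps_X) ^ (m * ns k)
        - Abs_fps (\<lambda>i. of_nat ((m - 1 choose i) * (ns k - 1 choose i))) / (1 - fps_X) ^ (m + ns k - 1)))"
proof -
  have m: "m > 0" using assms(1) by simp
  have "ns r \<le> n" using assms(2,9) by (simp add: member_le_sum)
  then have npos: "n > 0" using assms(4) by simp
  define F :: "nat \<Rightarrow> rat fps" where "F k = Abs_fps (\<lambda>d. of_nat (multichoose (m * ns k) d))
    - Abs_fps (\<lambda>d. of_nat (multichoose m d * multichoose (ns k) d))" for k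
  have F: "1 / (1 - fps_X) ^ (m * ns k)
      - Abs_fps (\<lambda>i. of_nat ((m - 1 choose i) * (ns k - 1 choose i))) / (1 - fps_X) ^ (m + ns k - 1) = F k"
    if "k \<in> {s..r}" for k
  proof -
    have pos: "ns k > 0" using that assms(3,5) by simp
    then have "1 / (1 - fps_X) ^ (m * ns k) = (Abs_fps (\<lambda>d. of_nat (multichoose (m * ns k) d)) :: rat fps)"
      using inverse_one_minus_fps_X_power[of "m * ns k", where 'a = rat] m
      by (simp add: fps_divide_unit fps_power_zeroth)
    then show ?thesis unfolding F_def using segre_hilbert_series[OF m pos] by simp
  qed
  \<comment> \<open>A block with one vertex contributes nothing, as
    \<open>multichoose 1 d = 1\<close>; so the sum over all blocks may start at
    \<open>s\<close>.\<close>
  have "F k = 0" if "1 \<le> k" "k < s" for k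
    using assms(6)[OF that] by (simp add: F_def multichoose_def)
  then have "sum F {s..r} = sum F {1..r}"
    using assms(5) by (intro sum.mono_neutral_left) auto
  moreover have "hilbert_series m n J =
      Abs_fps (\<lambda>d. of_nat (multichoose m d * multichoose n d)) + sum F {1..r}"
    by (rule fps_ext) (simp add: hilbert_series_nth[OF assms(9,10)] fps_sum_nth F_def)
  moreover have "sum F {s..r} = (\<Sum>k = s..r. (1 / (1 - fps_X) ^ (m * ns k)
        - Abs_fps (\<lambda>i. of_nat ((m - 1 choose i) * (ns k - 1 choose i))) / (1 - fps_X) ^ (m + ns k - 1)))"
    by (rule sum.cong) (simp_all only: F)
  ultimately show ?thesis
    unfolding segre_hilbert_series[OF m npos] by simp
qed

end
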